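(* Let $d\ge 1$ and let $(\mathbf X,Y)$ be a random vector in $\mathbb R^{d}\times\mathbb R$ with $\mathbb E[Y^2]<\infty$ such that $\mathbf X$ is marginally atomless. Let $\{M_k\}_{k\ge 0}$ be the process associated with $(\mathbf X,Y)$ constructed from the cyclic MinimaxSplit algorithm. Then for every $\delta>0$ and every integer $k\ge 0$, $$\mathbb E[(Y-M_k)^2]\le \inf_{g\in\mathcal G}\Bigg(\Big((1+\delta)+\frac{2(1+\delta)(1+\delta^{-1})}{3\cdot 2^{2\lfloor k/d\rfloor/3}}\Big)\,\mathbb E[(Y-g(\mathbf X))^2]+(1+\delta^{-1})\bigg(\frac13+\Big(\frac{1+\delta^{-1}}{4}\Big)^{2/3}\bigg)2^{-2\lfloor k/d\rfloor/3}\|g\|_{\mathrm{TV}}^2\Bigg).$$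
   Context: Write $[d]=\{1,\dots,d\}$. The vector $\mathbf X=(X_1,\dots,X_d)$ is marginally atomless if $\mathbb P(X_j=x)=0$ for all $j\in[d]$, $x\in\mathbb R$. A set $A\subseteq\mathbb R^d$ is unsplittable if $\mathbb P(\mathbf X\in A)=0$, or if $\mathbb P(\mathbf X\in A)>0$ and the conditional law of $Y$ given $\mathbf X\in A$ is a point mass, or if $\mathbb P(\mathbf X\in A)>0$ and the conditional law of $\mathbf X$ given $\mathbf X\in A$ is a point mass. Otherwise $A$ is splittable. Cyclic MinimaxSplit algorithm: nested partitions $\{\pi_k\}_{k\ge0}$ of $\mathbb R^d$ into axis-aligned boxes $A=[a_1,b_1)\times\dots\times[a_d,b_d)$ (with $a_i,b_i\in\mathbb R\cup\{\pm\infty\}$ and $[-\infty,b)$ read as $(-\infty,b)$) are built recursively. $\pi_0=\{\mathbb R^d\}$. Given $\pi_k$, let $j=1+(k \bmod d)$. Every unsplittable $A\in\pi_k$ is kept as an element of $\pi_{k+1}$. Every splittable $A\in\pi_k$ is replaced in $\pi_{k+1}$ by $A\cap\{x_j<\hat x_j\}$ and $A\cap\{x_j\ge\hat x_j\}$, where $$\hat x_j\in\operatorname*{arg\,min}_{x_j\in[a_j,b_j)}\max\big\{\mathbb P(\mathbf X\in A,X_j<x_j)\operatorname{Var}(Y\mid \mathbf X\in A,X_j<x_j),\ \mathbb P(\mathbf X\in A,X_j\ge x_j)\operatorname{Var}(Y\mid\mathbf X\in A,X_j\ge x_j)\big\},$$ ties being broken arbitrarily (products with a zero-probability event are $0$;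 the arg min is assumed attained). The associated process is $M_k=\mathbb E[Y\mid\mathbf X\in A]$ on the event $\{\mathbf X\in A\}$, for $A\in\pi_k$. $\mathcal G$ is the class of additive functions $g(\mathbf x)=g_1(x_1)+\dots+g_d(x_d)$ on $\mathbb R^d$ with each $g_i:\mathbb R\to\mathbb R$ of bounded variation, and $\|g\|_{\mathrm{TV}}$ is the infimum of $\sum_{i=1}^d\|g_i\|_{\mathrm{TV}}$ over all such additive representations of $g$, where $\|g_i\|_{\mathrm{TV}}$ is the total variation of $g_i$. *)

theory Defs
  imports "HOL-Probability.Probability"
begin

(* Points of R^d are the elements of {1..d} ->E UNIV, i.e. functions that are undefined outside
   {1..d}; its Borel sigma-algebra is the product sigma-algebra. *)
definition rspace :: "nat \<Rightarrow> (nat \<Rightarrow> real) measure" where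
  "rspace d = (\<Pi>\<^sub>M j\<in>{1..d}. borel)"

definition marginally_atomless :: "nat \<Rightarrow> 'w measure \<Rightarrow> ('w \<Rightarrow> nat \<Rightarrow> real) \<Rightarrow> bool" where
  "marginally_atomless d M X \<longleftrightarrow>
     (\<forall>j\<in>{1..d}. \<forall>x. measure M {\<omega> \<in> space M. X \<omega> j = x} = 0)"

definition in_event :: "'w measure \<Rightarrow> ('w \<Rightarrow> nat \<Rightarrow> real) \<Rightarrow> (nat \<Rightarrow> real) set \<Rightarrow> 'w set" where
  "in_event M X A = {\<omega> \<in> space M. X \<omega> \<in> A}"

(* On an event of probability zero, uniform_measure is the null measure, so that
   the conditional mean and variance below are 0 there. *)
definition cmean :: "'w measure \<Rightarrow> ('w \<Rightarrow> real) \<Rightarrow> 'w set \<Rightarrow> real" where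
  "cmean M Y E = (\<integral>\<omega>. Y \<omega> \<partial>uniform_measure M E)"

definition cvar :: "'w measure \<Rightarrow> ('w \<Rightarrow> real) \<Rightarrow> 'w set \<Rightarrow> real" where
  "cvar M Y E = (\<integral>\<omega>. (Y \<omega> - cmean M Y E)\<^sup>2 \<partial>uniform_measure M E)"

definition unsplittable ::
  "nat \<Rightarrow> 'w measure \<Rightarrow> ('w \<Rightarrow> nat \<Rightarrow> real) \<Rightarrow> ('w \<Rightarrow> real) \<Rightarrow> (nat \<Rightarrow> real) set \<Rightarrow> bool" where
  "unsplittable d M X Y A \<longleftrightarrow>
     measure M (in_event M X A) = 0 \<or>
     measure M (in_event M X A) > 0 \<and>
       (\<exists>c. distr (uniform_measure M (in_event M X A)) borel Y = return borel c) \<or>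
     measure M (in_event M X A) > 0 \<and>
       (\<exists>c\<in>space (rspace d).
          distr (uniform_measure M (in_event M X A)) (rspace d) X = return (rspace d) c)"

definition box_of :: "nat \<Rightarrow> (nat \<Rightarrow> ereal) \<Rightarrow> (nat \<Rightarrow> ereal) \<Rightarrow> (nat \<Rightarrow> real) set" where
  "box_of d a b = {x \<in> space (rspace d). \<forall>j\<in>{1..d}. a j \<le> ereal (x j) \<and> ereal (x j) < b j}"

definition split_objective ::
  "'w measure \<Rightarrow> ('w \<Rightarrow> nat \<Rightarrow> real) \<Rightarrow> ('w \<Rightarrow> real) \<Rightarrow> nat \<Rightarrow> (nat \<Rightarrow> real) set \<Rightarrow> real \<Rightarrow> real" where
  "split_objective M X Y j A t =
     (let L = in_event M X (A \<inter> {x. x j < t}); R = in_event M X (A \<inter> {x. x j \<ge> t})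
      in max (measure M L * cvar M Y L) (measure M R * cvar M Y R))"

definition minimax_split_point ::
  "nat \<Rightarrow> 'w measure \<Rightarrow> ('w \<Rightarrow> nat \<Rightarrow> real) \<Rightarrow> ('w \<Rightarrow> real) \<Rightarrow> nat \<Rightarrow> (nat \<Rightarrow> real) set \<Rightarrow> real \<Rightarrow> bool" where
  "minimax_split_point d M X Y j A t \<longleftrightarrow>
     (\<exists>a b. A = box_of d a b \<and>
        is_arg_min (split_objective M X Y j A) (\<lambda>s. a j \<le> ereal s \<and> ereal s < b j) t)"

(* The function xi records the chosen split points, i.e. how ties are broken. *)
definition minimax_step ::
  "nat \<Rightarrow> 'w measure \<Rightarrow> ('w \<Rightarrow> nat \<Rightarrow> real) \<Rightarrow> ('w \<Rightarrow> real) \<Rightarrow> nat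
     \<Rightarrow> (nat \<Rightarrow> real) set set \<Rightarrow> (nat \<Rightarrow> real) set set \<Rightarrow> bool" where
  "minimax_step d M X Y j P Q \<longleftrightarrow>
     (\<exists>\<xi>. (\<forall>A\<in>P. \<not> unsplittable d M X Y A \<longrightarrow> minimax_split_point d M X Y j A (\<xi> A)) \<and>
          Q = (\<Union>A\<in>P. if unsplittable d M X Y A then {A}
                      else {A \<inter> {x. x j < \<xi> A}, A \<inter> {x. x j \<ge> \<xi> A}}))"

definition cyclic_minimax_partitions ::
  "nat \<Rightarrow> 'w measure \<Rightarrow> ('w \<Rightarrow> nat \<Rightarrow> real) \<Rightarrow> ('w \<Rightarrow> real) \<Rightarrow> (nat \<Rightarrow> (nat \<Rightarrow> real) set set) \<Rightarrow> bool" where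
  "cyclic_minimax_partitions d M X Y \<pi> \<longleftrightarrow>
     \<pi> 0 = {space (rspace d)} \<and>
     (\<forall>k. minimax_step d M X Y (1 + k mod d) (\<pi> k) (\<pi> (Suc k)))"

definition associated_process ::
  "'w measure \<Rightarrow> ('w \<Rightarrow> nat \<Rightarrow> real) \<Rightarrow> ('w \<Rightarrow> real) \<Rightarrow> (nat \<Rightarrow> (nat \<Rightarrow> real) set set)
     \<Rightarrow> (nat \<Rightarrow> 'w \<Rightarrow> real) \<Rightarrow> bool" where
  "associated_process M X Y \<pi> Z \<longleftrightarrow>
     (\<forall>k. \<forall>A\<in>\<pi> k. \<forall>\<omega>\<in>in_event M X A. Z k \<omega> = cmean M Y (in_event M X A))"

definition cyclic_minimax_process ::
  "nat \<Rightarrow> 'w measure \<Rightarrow> ('w \<Rightarrow> nat \<Rightarrow> real) \<Rightarrow> ('w \<Rightarrow> real) \<Rightarrow> (nat \<Rightarrow> 'w \<Rightarrow> real) \<Rightarrow> bool" where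
  "cyclic_minimax_process d M X Y Z \<longleftrightarrow>
     (\<exists>\<pi>. cyclic_minimax_partitions d M X Y \<pi> \<and> associated_process M X Y \<pi> Z)"

definition variation_sums :: "(real \<Rightarrow> real) \<Rightarrow> real set" where
  "variation_sums f = {(\<Sum>i<n. \<bar>f (t (Suc i)) - f (t i)\<bar>) | (n::nat) (t::nat \<Rightarrow> real). mono t}"

definition bounded_variation :: "(real \<Rightarrow> real) \<Rightarrow> bool" where
  "bounded_variation f \<longleftrightarrow> bdd_above (variation_sums f)"

definition total_variation :: "(real \<Rightarrow> real) \<Rightarrow> real" where
  "total_variation f = Sup (variation_sums f)"

definition additive_rep ::
  "nat \<Rightarrow> ((nat \<Rightarrow> real) \<Rightarrow> real) \<Rightarrow> (nat \<Rightarrow> real \<Rightarrow> real) \<Rightarrow> bool" where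
  "additive_rep d g h \<longleftrightarrow>
     (\<forall>i\<in>{1..d}. bounded_variation (h i)) \<and>
     (\<forall>x\<in>space (rspace d). g x = (\<Sum>i\<in>{1..d}. h i (x i)))"

definition additive_class :: "nat \<Rightarrow> ((nat \<Rightarrow> real) \<Rightarrow> real) set" where
  "additive_class d = {g. \<exists>h. additive_rep d g h}"

definition tv_norm :: "nat \<Rightarrow> ((nat \<Rightarrow> real) \<Rightarrow> real) \<Rightarrow> real" where
  "tv_norm d g = Inf {(\<Sum>i\<in>{1..d}. total_variation (h i)) | h. additive_rep d g h}"

end

theory Submission
  imports Defs
begin

text \<open>
  Write \<open>v A\<close> for the probability of a cell \<open>A\<close> times the conditional variance of \<open>Y\<close> on it. Along
  an atomless coordinate the weighted variance of the left part is continuous in the split point, so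
  some split gives it exactly half of \<open>v A\<close>; as the weighted variance is superadditive, a minimax
  split then at least halves it on both sides, and cells of depth \<open>k\<close> have
  \<open>v A \<le> Var Y / 2^k\<close>. On the other hand \<open>v A\<close> is at most \<open>1 + \<delta>\<close> times the contribution of \<open>A\<close> to
  the squared error of \<open>g\<close> plus \<open>(1 + 1/\<delta>)/4 * P A * (osc A)^2\<close>, with \<open>osc A\<close> the oscillation of \<open>g\<close>.
  Splitting along coordinate \<open>j\<close> does not increase the sum over all cells of the \<open>j\<close>-th oscillation and
  the other splits at most double it, so the oscillations sum to at most \<open>2^(k - k div d) * TV g\<close>.
  Interpolating the two bounds with exponents 2/3 and 1/3 and applying Hoelder's inequality to
  \<open>(P A)^(1/3) * (osc A)^(2/3)\<close> gives the rate \<open>2^(-2 (k div d) / 3)\<close>.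
\<close>

subsection \<open>Variation and oscillation\<close>

text \<open>\<open>F x\<close> is the variation of \<open>f\<close> up to \<open>x\<close>. Being
  monotone, it replaces \<open>f\<close> wherever oscillations must add up over an ordered
  cut.\<close>

lemma variation_function:
  fixes f :: "real \<Rightarrow> real"
  assumes bv: "bounded_variation f"
  shows "\<exists>F. (\<forall>x y. x \<le> y \<longrightarrow> \<bar>f y - f x\<bar> \<le> F y - F x) \<and> (\<forall>x y. F y - F x \<le> total_variation f)"
proof -
  define V where "V x = {(\<Sum>i<n. \<bar>f (t (Suc i)) - f (t i)\<bar>) | (n::nat) (t::nat \<Rightarrow> real).
    mono t \<and> (\<forall>i. t i \<le> x)}" for x
  define F where "F x = Sup (V x)" for x
  have sub: "V x \<subseteq> variation_sums f" for x
    unfolding V_def variation_sums_def by blast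
  have bdd: "bdd_above (variation_sums f)"
    using bv by (simp add: bounded_variation_def)
  have zero: "0 \<in> V x" for x
    unfolding V_def by (auto intro!: exI[of _ 0] exI[of _ "\<lambda>_. x"] simp: mono_def)
  have bddV: "bdd_above (V x)" for x
    using bdd sub by (rule bdd_above_mono)
  have F0: "0 \<le> F x" for x
    unfolding F_def using zero bddV by (rule cSup_upper)
  have FT: "F x \<le> total_variation f" for x
    unfolding F_def total_variation_def
    using zero[of x] bdd sub by (intro cSup_subset_mono) auto
  show ?thesis
  proof (intro exI[of _ F] conjI allI impI)
    show "F y - F x \<le> total_variation f" for x y
      using F0[of x] FT[of y] by simp
    fix x y :: real assume "x \<le> y"
    have "F x \<le> F y - \<bar>f y - f x\<bar>"
      unfolding F_def[of x]
    proof (rule cSup_least)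
      show "V x \<noteq> {}" using zero by blast
      fix v assume "v \<in> V x"
      then obtain n t where t: "v = (\<Sum>i<n. \<bar>f (t (Suc i)) - f (t i)\<bar>)" "mono t" "\<And>i. t i \<le> x"
        unfolding V_def by blast
      \<comment> \<open>The chain \<open>t\<close> is prolonged by \<open>x\<close> and then by
        \<open>y\<close> forever: of the two new increments, the one from \<open>t n\<close> to
        \<open>x\<close> is nonnegative and the other is the increment wanted.\<close>
      define s where "s i = (if i \<le> n then t i else if i = Suc n then x else y)" for i
      have "mono s"
        unfolding mono_def s_def
        using t(2,3) \<open>x \<le> y\<close> by (auto dest: monoD intro: order_trans)
      moreover have "s i \<le> y" for i
        using t(3)[of i] \<open>x \<le> y\<close> by (auto simp: s_def)
      ultimately have "(\<Sum>i<Suc (Suc n). \<bar>f (s (Suc i)) - f (s i)\<bar>) \<in> V y"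
        unfolding V_def by blast
      then have "(\<Sum>i<Suc (Suc n). \<bar>f (s (Suc i)) - f (s i)\<bar>) \<le> F y"
        unfolding F_def using bddV by (rule cSup_upper)
      moreover have "(\<Sum>i<n. \<bar>f (s (Suc i)) - f (s i)\<bar>) = v"
        unfolding t by (intro sum.cong) (auto simp: s_def)
      ultimately show "v \<le> F y - \<bar>f y - f x\<bar>"
        by (simp add: s_def)
    qed
    then show "\<bar>f y - f x\<bar> \<le> F y - F x" by simp
  qed
qed

text \<open>Jordan decomposition: \<open>f\<close> is the difference of the monotone functions
  \<open>F\<close> and \<open>F - f\<close>.\<close>

lemma bounded_variation_borel_measurable:
  fixes f :: "real \<Rightarrow> real"
  assumes "bounded_variation f"
  shows "f \<in> borel_measurable borel"
proof -
  obtain F where F: "\<And>x y. x \<le> y \<Longrightarrow> \<bar>f y - f x\<bar> \<le> F y - F x"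
    using variation_function[OF assms] by blast
  have "F x \<le> F y" "F x - f x \<le> F y - f y" if "x \<le> y" for x y
    using F[OF that] by linarith+
  then have "mono F" "mono (\<lambda>x. F x - f x)"
    by (simp_all add: mono_def)
  then have "(\<lambda>x. F x - (F x - f x)) \<in> borel_measurable borel"
    by (intro borel_measurable_diff borel_measurable_mono)
  then show ?thesis by simp
qed

text \<open>A pair from \<open>S\<close> and a pair from \<open>T\<close> span two intervals that do
  not overlap, and both lie between the smallest and the largest of the four points.\<close>

lemma diameter_add_le:
  fixes S T :: "real set"
  assumes bdd: "bounded (S \<union> T)" and le: "\<And>x y. x \<in> S \<Longrightarrow> y \<in> T \<Longrightarrow> x \<le> y"
  shows "diameter S + diameter T \<le> diameter (S \<union> T)"
proof (cases "S = {} \<or> T = {}")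
  case True
  then show ?thesis by auto
next
  case False
  have "\<bar>x - x'\<bar> + \<bar>y - y'\<bar> \<le> diameter (S \<union> T)"
    if "x \<in> S" "x' \<in> S" "y \<in> T" "y' \<in> T" for x x' y y'
  proof -
    have "dist (min x x') (max y y') \<le> diameter (S \<union> T)"
      using that by (intro diameter_bounded_bound[OF bdd]) (auto simp: min_def max_def)
    moreover have "max x x' \<le> min y y'"
      using le that by simp
    ultimately show ?thesis
      by (auto simp: dist_real_def abs_real_def min_def max_def split: if_splits)
  qed
  \<comment> \<open>The supremum is taken over pairs of \<open>S\<close> with the pair of
    \<open>T\<close> held fixed, and only then over pairs of \<open>T\<close>.\<close>
  then have "diameter S \<le> diameter (S \<union> T) - \<bar>y - y'\<bar>" if "y \<in> T" "y' \<in> T" for y y'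
    using False that by (intro diameter_le) (auto simp: algebra_simps)
  then have "diameter T \<le> diameter (S \<union> T) - diameter S"
    using False by (intro diameter_le) (force simp: algebra_simps)+
  then show ?thesis by simp
qed

text \<open>The centre is the mean of supremum and infimum. Halving the distance here is the source
  of the factor 1/4 in front of the squared oscillation.\<close>

lemma midpoint_of_oscillation:
  fixes f :: "'a \<Rightarrow> real"
  assumes "\<And>x y. x \<in> A \<Longrightarrow> y \<in> A \<Longrightarrow> \<bar>f x - f y\<bar> \<le> D"
  shows "\<exists>c. \<forall>x\<in>A. \<bar>f x - c\<bar> \<le> D / 2"
proof (cases "A = {}")
  case False
  then obtain a where a: "a \<in> A" by blast
  have bdd: "bdd_above (f ` A)" "bdd_below (f ` A)"
    using assms[OF _ a] by (auto intro!: bdd_aboveI2[of _ _ "f a + D"] bdd_belowI2[of _ "f a - D"] simp: abs_le_iff algebra_simps)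
  have "(SUP x\<in>A. f x) \<le> f y + D" if "y \<in> A" for y
    using assms[OF _ that] False by (intro cSUP_least) (auto simp: abs_le_iff algebra_simps)
  then have "(SUP x\<in>A. f x) - D \<le> (INF x\<in>A. f x)"
    using False by (intro cINF_greatest) (auto simp: algebra_simps)
  then have "\<bar>f x - ((SUP x\<in>A. f x) + (INF x\<in>A. f x)) / 2\<bar> \<le> D / 2" if "x \<in> A" for x
    using cSUP_upper[OF that bdd(1)] cINF_lower[OF bdd(2) that] by (simp add: abs_le_iff field_simps)
  then show ?thesis by blast
qed simp

section \<open>Sums over overlapping families, and interpolation between two bounds\<close>

lemma sum_UN_le:
  fixes f :: "'b \<Rightarrow> real"
  assumes "finite I" "\<And>i. i \<in> I \<Longrightarrow> finite (B i)" "\<And>x. 0 \<le> f x"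
  shows "sum f (\<Union>i\<in>I. B i) \<le> (\<Sum>i\<in>I. sum f (B i))"
  using assms(1,2)
proof (induction I rule: finite_induct)
  case (insert i I)
  \<comment> \<open>The families may share members, for instance an empty cell that arises from
    several parents; a shared member is counted once on the left, so nonnegativity yields an
    inequality.\<close>
  have "sum f (B i \<union> (\<Union>i\<in>I. B i)) \<le> sum f (B i) + sum f (\<Union>i\<in>I. B i)"
    using insert.prems insert.hyps sum_nonneg[of "B i \<inter> (\<Union>i\<in>I. B i)" f] assms(3)
    by (subst sum_Un) auto
  then show ?case using insert by simp
qed simp

lemma sum_pair_le:
  fixes f :: "'b \<Rightarrow> real"
  assumes "\<And>x. 0 \<le> f x"
  shows "sum f {a, b} \<le> f a + f b"
  using assms[of b] by (cases "a = b") auto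

text \<open>The parameter \<open>s\<close> linearises Hoelder's inequality: optimising it after summation over the cells
  replaces the sum of \<open>p^(1/3) * D^(2/3)\<close>.\<close>
lemma min_le_interpolation:
  fixes b w c p D s :: real
  assumes "0 \<le> w" "0 < c" "0 \<le> p" "0 \<le> D" "0 < s"
  shows "min (c * p * D\<^sup>2) w \<le> w powr (2/3) * c powr (1/3) * (p * s\<^sup>2 / 3 + 2 * D / (3 * s))"
proof (cases "w = 0 \<or> p = 0 \<or> D = 0")
  case True
  then show ?thesis
    using assms by (auto simp: min_def)
next
  case False
  with assms have pos: "0 < w" "0 < p" "0 < D" by auto
  \<comment> \<open>The minimum is split into its powers 2/3 and 1/3; the first is then bounded
    through \<open>w\<close>, the second through \<open>c * p * D\<^sup>2\<close>.\<close>
  have "min (c * p * D\<^sup>2) w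
      = min (c * p * D\<^sup>2) w powr (2/3) * min (c * p * D\<^sup>2) w powr (1/3)"
    using pos assms by (subst powr_add[symmetric]) simp
  also have "\<dots> \<le> w powr (2/3) * (c * p * D\<^sup>2) powr (1/3)"
    using pos assms by (intro mult_mono powr_mono2) auto
  also have "(c * p * D\<^sup>2) powr (1/3) = c powr (1/3) * ((D / s) powr (2/3) * (p * s\<^sup>2) powr (1/3))"
    using pos assms by (simp add: powr_mult powr_divide powr_powr flip: powr_numeral)
  \<comment> \<open>Young's inequality with weights 2/3 and 1/3; the powers of \<open>s\<close>
    cancel in the product on the left.\<close>
  also have "(D / s) powr (2/3) * (p * s\<^sup>2) powr (1/3) \<le> 2/3 * (D / s) + 1/3 * (p * s\<^sup>2)"
    using pos assms by (intro Youngs_inequality_0) auto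
  finally show ?thesis
    by (simp add: mult.assoc mult_left_mono add.commute mult.commute[of p])
qed

subsection \<open>Probability-weighted conditional variance\<close>

text \<open>This is the quantity compared by the minimax split. Unlike the conditional variance it
  is superadditive in the event, and it vanishes on null events.\<close>

definition wvar :: "'w measure \<Rightarrow> ('w \<Rightarrow> real) \<Rightarrow> 'w set \<Rightarrow> real" where
  "wvar M Y E = measure M E * cvar M Y E"

lemma integrable_square_diff:
  fixes f g :: "'a \<Rightarrow> real"
  assumes [measurable]: "f \<in> borel_measurable M" "g \<in> borel_measurable M"
    and int: "integrable M (\<lambda>x. (f x)\<^sup>2)" "integrable M (\<lambda>x. (g x)\<^sup>2)"
  shows "integrable M (\<lambda>x. (f x - g x)\<^sup>2)"
proof (rule Bochner_Integration.integrable_bound)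
  show "integrable M (\<lambda>x. 2 * (f x)\<^sup>2 + 2 * (g x)\<^sup>2)"
    using int by simp
  have "(a - b)\<^sup>2 \<le> 2 * a\<^sup>2 + 2 * b\<^sup>2" for a b :: real
    using zero_le_power2[of "a + b"] by (simp add: power2_eq_square algebra_simps)
  then show "AE x in M. norm ((f x - g x)\<^sup>2) \<le> norm (2 * (f x)\<^sup>2 + 2 * (g x)\<^sup>2)"
    by simp
qed measurable

context prob_space
begin

lemma integral_uniform_measure:
  fixes f :: "'a \<Rightarrow> real"
  assumes [measurable]: "E \<in> sets M" "f \<in> borel_measurable M" and pos: "prob E > 0"
  shows "(\<integral>x. f x \<partial>uniform_measure M E) = (\<integral>x. indicator E x * f x \<partial>M) / prob E"
proof -
  have "uniform_measure M E = density M (\<lambda>x. ennreal (indicator E x / prob E))"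
    unfolding uniform_measure_def
    using pos by (intro density_cong) (auto simp: emeasure_eq_measure indicator_def divide_ennreal ennreal_1[symmetric] simp del: ennreal_1)
  then have "(\<integral>x. f x \<partial>uniform_measure M E) = (\<integral>x. (indicator E x / prob E) *\<^sub>R f x \<partial>M)"
    by (simp add: integral_density)
  then show ?thesis by simp
qed

lemma wvar_empty: "wvar M Y {} = 0"
  by (simp add: wvar_def)

lemma integral_indicator_null:
  fixes f :: "'a \<Rightarrow> real"
  assumes "E \<in> sets M" "prob E = 0"
  shows "(\<integral>x. indicator E x * f x \<partial>M) = 0"
proof -
  have "AE x in M. x \<notin> E"
    using assms by (intro AE_not_in) (auto simp: null_sets_def emeasure_eq_measure)
  then show ?thesis
    by (intro integral_eq_zero_AE) auto
qed

context
  fixes Y :: "'a \<Rightarrow> real"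
  assumes Y [measurable]: "Y \<in> borel_measurable M"
    and Y2: "integrable M (\<lambda>x. (Y x)\<^sup>2)"
begin

lemma integrable_Y: "integrable M Y"
  using Y2 Y square_integrable_imp_integrable by blast

lemma integrable_indicator_Y:
  assumes [measurable]: "E \<in> sets M"
  shows "integrable M (\<lambda>x. indicator E x * Y x)" "integrable M (\<lambda>x. indicator E x * (Y x)\<^sup>2)"
    "integrable M (\<lambda>x. indicator E x * (Y x - c)\<^sup>2)"
proof -
  have "integrable M (\<lambda>x. (Y x - c)\<^sup>2)"
    by (intro integrable_square_diff) (auto simp: Y2)
  then show "integrable M (\<lambda>x. indicator E x * Y x)" "integrable M (\<lambda>x. indicator E x * (Y x)\<^sup>2)"
    "integrable M (\<lambda>x. indicator E x * (Y x - c)\<^sup>2)"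
    using integrable_Y Y2 by (auto intro!: integrable_real_mult_indicator simp: mult.commute[of "indicator _ _"])
qed

lemma integral_indicator_square_diff:
  assumes [measurable]: "E \<in> sets M"
  shows "(\<integral>x. indicator E x * (Y x - c)\<^sup>2 \<partial>M)
    = (\<integral>x. indicator E x * (Y x)\<^sup>2 \<partial>M) - 2 * c * (\<integral>x. indicator E x * Y x \<partial>M) + c\<^sup>2 * prob E"
proof -
  have "(\<integral>x. indicator E x * (Y x - c)\<^sup>2 \<partial>M)
    = (\<integral>x. indicator E x * (Y x)\<^sup>2 - 2 * c * (indicator E x * Y x) + c\<^sup>2 * indicator E x \<partial>M)"
    by (intro Bochner_Integration.integral_cong) (auto simp: power2_eq_square algebra_simps)
  also have "\<dots> = (\<integral>x. indicator E x * (Y x)\<^sup>2 \<partial>M) - 2 * c * (\<integral>x. indicator E x * Y x \<partial>M)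
      + c\<^sup>2 * prob E"
    using integrable_indicator_Y[OF assms] integrable_real_indicator[of E M]
    by (simp add: emeasure_eq_measure)
  finally show ?thesis .
qed

lemma wvar_eq_integral:
  assumes [measurable]: "E \<in> sets M"
  shows "wvar M Y E = (\<integral>x. indicator E x * (Y x - cmean M Y E)\<^sup>2 \<partial>M)"
proof (cases "prob E = 0")
  case True
  then show ?thesis
    by (simp add: wvar_def integral_indicator_null)
next
  case False
  then have "prob E > 0" using measure_nonneg[of M E] by linarith
  then show ?thesis
    by (simp add: wvar_def cvar_def integral_uniform_measure)
qed

text \<open>Expresses the weighted variance through three integrals over the event, to which
  dominated convergence applies. On a null event the quotient is 0 by the convention for
  division.\<close>

lemma wvar_eq:
  assumes [measurable]: "E \<in> sets M"
  shows "wvar M Y E = (\<integral>x. indicator E x * (Y x)\<^sup>2 \<partial>M) - (\<integral>x. indicator E x * Y x \<partial>M)\<^sup>2 / prob E"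
proof (cases "prob E = 0")
  case True
  then show ?thesis
    by (simp add: wvar_def integral_indicator_null)
next
  case False
  then have pos: "prob E > 0" using measure_nonneg[of M E] by linarith
  have mean: "cmean M Y E = (\<integral>x. indicator E x * Y x \<partial>M) / prob E"
    unfolding cmean_def using pos by (simp add: integral_uniform_measure)
  show ?thesis
    using pos unfolding wvar_eq_integral[OF assms] integral_indicator_square_diff[OF assms] mean
    by (simp add: field_simps power2_eq_square)
qed

text \<open>The mean is the best constant: the excess for another constant \<open>c\<close> is the
  square of the integral of \<open>Y - c\<close> over \<open>E\<close>, divided by the
  probability.\<close>

lemma wvar_le:
  assumes [measurable]: "E \<in> sets M"
  shows "wvar M Y E \<le> (\<integral>x. indicator E x * (Y x - c)\<^sup>2 \<partial>M)"
proof (cases "prob E = 0")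
  case True
  then show ?thesis
    by (simp add: wvar_def integral_indicator_null)
next
  case False
  then have pos: "prob E > 0" using measure_nonneg[of M E] by linarith
  let ?y = "\<integral>x. indicator E x * Y x \<partial>M"
  have "0 \<le> (?y - c * prob E)\<^sup>2 / prob E"
    using pos by simp
  also have "\<dots> = ?y\<^sup>2 / prob E - 2 * c * ?y + c\<^sup>2 * prob E"
    using pos by (simp add: field_simps power2_eq_square)
  finally show ?thesis
    unfolding wvar_eq[OF assms] integral_indicator_square_diff[OF assms] by simp
qed

lemma wvar_nonneg: "E \<in> sets M \<Longrightarrow> 0 \<le> wvar M Y E"
  by (simp add: wvar_eq_integral)

text \<open>Both parts are compared with one common centre, the mean over the union.\<close>

lemma wvar_split:
  assumes [measurable]: "E \<in> sets M" "F \<in> sets M" and disj: "E \<inter> F = {}"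
  shows "wvar M Y E + wvar M Y F \<le> wvar M Y (E \<union> F)"
proof -
  define c where "c = cmean M Y (E \<union> F)"
  have "wvar M Y E + wvar M Y F
      \<le> (\<integral>x. indicator E x * (Y x - c)\<^sup>2 \<partial>M) + (\<integral>x. indicator F x * (Y x - c)\<^sup>2 \<partial>M)"
    by (intro add_mono wvar_le) measurable
  also have "\<dots> = (\<integral>x. indicator E x * (Y x - c)\<^sup>2 + indicator F x * (Y x - c)\<^sup>2 \<partial>M)"
    by (intro Bochner_Integration.integral_add[symmetric] integrable_indicator_Y) measurable
  also have "\<dots> = (\<integral>x. indicator (E \<union> F) x * (Y x - c)\<^sup>2 \<partial>M)"
    using disj by (intro Bochner_Integration.integral_cong) (auto split: split_indicator)
  also have "\<dots> = wvar M Y (E \<union> F)"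
    unfolding c_def by (rule wvar_eq_integral[symmetric]) measurable
  finally show ?thesis .
qed

section \<open>Continuity of the weighted variance in the event, and the halving threshold\<close>

lemma tendsto_integral_indicator:
  fixes f :: "'a \<Rightarrow> real"
  assumes [measurable]: "\<And>n. E n \<in> sets M" "E' \<in> sets M" and f: "integrable M f"
    and lim: "AE x in M. (\<lambda>n. indicator (E n) x :: real) \<longlonglongrightarrow> indicator E' x"
  shows "(\<lambda>n. \<integral>x. indicator (E n) x * f x \<partial>M) \<longlonglongrightarrow> (\<integral>x. indicator E' x * f x \<partial>M)"
proof (rule integral_dominated_convergence)
  have [measurable]: "f \<in> borel_measurable M" using f by simp
  show "(\<lambda>x. indicator E' x * f x) \<in> borel_measurable M"
    and "\<And>n. (\<lambda>x. indicator (E n) x * f x) \<in> borel_measurable M" by measurable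
  show "integrable M (\<lambda>x. \<bar>f x\<bar>)" using f by simp
  show "AE x in M. (\<lambda>n. indicator (E n) x * f x) \<longlonglongrightarrow> indicator E' x * f x"
    using lim by eventually_elim (intro tendsto_intros)
  show "AE x in M. norm (indicator (E n) x * f x) \<le> \<bar>f x\<bar>" for n
    by (auto split: split_indicator)
qed

lemma tendsto_wvar:
  assumes [measurable]: "\<And>n. E n \<in> sets M" "E' \<in> sets M"
    and lim: "AE x in M. (\<lambda>n. indicator (E n) x :: real) \<longlonglongrightarrow> indicator E' x"
  shows "(\<lambda>n. wvar M Y (E n)) \<longlonglongrightarrow> wvar M Y E'"
proof -
  note * = tendsto_integral_indicator[OF assms(1,2) _ lim]
  have q: "(\<lambda>n. \<integral>x. indicator (E n) x * (Y x)\<^sup>2 \<partial>M) \<longlonglongrightarrow> (\<integral>x. indicator E' x * (Y x)\<^sup>2 \<partial>M)"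
    and y: "(\<lambda>n. \<integral>x. indicator (E n) x * Y x \<partial>M) \<longlonglongrightarrow> (\<integral>x. indicator E' x * Y x \<partial>M)"
    by (intro * Y2 integrable_Y)+
  have p: "(\<lambda>n. prob (E n)) \<longlonglongrightarrow> prob E'"
    using *[of "\<lambda>_. 1"] by simp
  show ?thesis
  proof (cases "prob E' = 0")
    case False
    then show ?thesis
      unfolding wvar_eq[OF assms(1)] wvar_eq[OF assms(2)] by (intro tendsto_intros q y p)
  next
    \<comment> \<open>For a null limit the quotient in \<open>wvar_eq\<close> is not continuous; the
      weighted variance is instead squeezed between 0 and the second moment over the event.\<close>
    case True
    have "(\<lambda>n. wvar M Y (E n)) \<longlonglongrightarrow> 0"
    proof (rule tendsto_sandwich[OF always_eventually always_eventually tendsto_const])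
      show "\<forall>n. 0 \<le> wvar M Y (E n)" by (simp add: wvar_nonneg)
      show "\<forall>n. wvar M Y (E n) \<le> (\<integral>x. indicator (E n) x * (Y x)\<^sup>2 \<partial>M)"
        using wvar_le[of _ 0] by simp
      show "(\<lambda>n. \<integral>x. indicator (E n) x * (Y x)\<^sup>2 \<partial>M) \<longlonglongrightarrow> 0"
        using q True by (simp add: integral_indicator_null)
    qed
    then show ?thesis using True by (simp add: wvar_def)
  qed
qed

text \<open>Intermediate value theorem for the weighted variance of the part below \<open>s\<close>:
  it tends to 0 and to the full value at the two ends, and it is continuous because each level set
  of \<open>U\<close> is null.\<close>

lemma halving_threshold:
  fixes U :: "'a \<Rightarrow> real"
  assumes [measurable]: "E \<in> sets M" "U \<in> borel_measurable M"
    and atomless: "\<And>x. prob {\<omega>\<in>space M. U \<omega> = x} = 0"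
    and pos: "0 < wvar M Y E"
  obtains s where "wvar M Y {\<omega>\<in>E. U \<omega> < s} = wvar M Y E / 2"
proof -
  define \<phi> where "\<phi> s = wvar M Y {\<omega>\<in>E. U \<omega> < s}" for s
  have sets: "{\<omega>\<in>E. U \<omega> < s} \<in> sets M" for s
  proof -
    have "{\<omega>\<in>E. U \<omega> < s} = E \<inter> {\<omega>\<in>space M. U \<omega> < s}"
      using sets.sets_into_space[OF assms(1)] by auto
    then show ?thesis by simp
  qed
  \<comment> \<open>One statement serves all three limits, at a finite threshold and at both
    infinities: almost every point eventually stops changing its membership.\<close>
  have lim: "(\<lambda>n. \<phi> (S n)) \<longlonglongrightarrow> wvar M Y E'"
    if E': "E' \<in> sets M" and conv: "AE \<omega> in M. eventually (\<lambda>n. (\<omega> \<in> E \<and> U \<omega> < S n) = (\<omega> \<in> E')) sequentially"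
    for S E'
    unfolding \<phi>_def
  proof (rule tendsto_wvar[OF sets E'])
    show "AE x in M. (\<lambda>n. indicator {\<omega>\<in>E. U \<omega> < S n} x :: real) \<longlonglongrightarrow> indicator E' x"
      using conv
    proof eventually_elim
      case (elim x)
      then show ?case
        by (intro tendsto_eventually) (auto elim!: eventually_mono split: split_indicator)
    qed
  qed
  have "isCont \<phi> s" for s
    unfolding isCont_def tendsto_at_iff_sequentially comp_def
  proof (intro allI impI)
    fix S :: "nat \<Rightarrow> real" assume S: "S \<longlonglongrightarrow> s"
    have "AE \<omega> in M. U \<omega> \<noteq> s"
      using atomless[of s] by (subst AE_iff_measurable[OF _ refl]) (auto simp: emeasure_eq_measure)
    then have "AE \<omega> in M. eventually (\<lambda>n. (\<omega> \<in> E \<and> U \<omega> < S n) = (\<omega> \<in> {\<omega>\<in>E. U \<omega> < s})) sequentially"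
    proof eventually_elim
      case (elim \<omega>)
      then consider "U \<omega> < s" | "s < U \<omega>" by linarith
      then show ?case
      proof cases
        case 1
        then show ?thesis using order_tendstoD(1)[OF S 1] by (auto elim!: eventually_mono)
      next
        case 2
        then show ?thesis using order_tendstoD(2)[OF S 2] by (auto elim!: eventually_mono)
      qed
    qed
    then show "(\<lambda>n. \<phi> (S n)) \<longlonglongrightarrow> \<phi> s"
      unfolding \<phi>_def[of s] by (rule lim[OF sets])
  qed
  then have cont: "continuous_on A \<phi>" for A
    by (auto intro: continuous_at_imp_continuous_on)
  have top: "filterlim (\<lambda>n. real n) at_top sequentially"
    by (rule filterlim_real_sequentially)
  have ev: "eventually (\<lambda>n. c < real n) sequentially" for c
    using top by (simp add: filterlim_at_top_dense)
  have "eventually (\<lambda>n. \<not> U \<omega> < - real n) sequentially" for \<omega>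
    using ev[of "- U \<omega>"] by eventually_elim simp
  then have "(\<lambda>n. \<phi> (- real n)) \<longlonglongrightarrow> wvar M Y {}"
    by (intro lim) (auto elim!: eventually_mono)
  moreover have "eventually (\<lambda>n. (\<omega> \<in> E \<and> U \<omega> < real n) = (\<omega> \<in> E)) sequentially" for \<omega>
    using ev[of "U \<omega>"] by eventually_elim simp
  then have "(\<lambda>n. \<phi> (real n)) \<longlonglongrightarrow> wvar M Y E"
    by (intro lim) simp_all
  ultimately have "eventually (\<lambda>n. \<phi> (- real n) < wvar M Y E / 2 \<and> wvar M Y E / 2 < \<phi> (real n)) sequentially"
    using pos by (intro eventually_conj order_tendstoD) (auto simp: wvar_empty)
  then obtain n where n: "\<phi> (- real n) < wvar M Y E / 2" "wvar M Y E / 2 < \<phi> (real n)"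
    by (auto simp: eventually_sequentially)
  have "\<exists>s\<ge>- real n. s \<le> real n \<and> \<phi> s = wvar M Y E / 2"
    using n by (intro IVT' cont) auto
  then show ?thesis
    using that unfolding \<phi>_def by blast
qed

end

end

subsection \<open>The nested partitions\<close>

text \<open>One run of the algorithm is fixed, with ties broken in some way.\<close>

locale cyclic_minimax = prob_space M for M :: "'w measure" +
  fixes d :: nat and X :: "'w \<Rightarrow> nat \<Rightarrow> real" and Y :: "'w \<Rightarrow> real"
    and \<pi> :: "nat \<Rightarrow> (nat \<Rightarrow> real) set set"
  assumes d: "1 \<le> d"
    and X [measurable]: "X \<in> measurable M (rspace d)"
    and Y [measurable]: "Y \<in> borel_measurable M"
    and Y2: "integrable M (\<lambda>\<omega>. (Y \<omega>)\<^sup>2)"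
    and atomless: "marginally_atomless d M X"
    and partitions: "cyclic_minimax_partitions d M X Y \<pi>"
begin

abbreviation ev :: "(nat \<Rightarrow> real) set \<Rightarrow> 'w set" where
  "ev \<equiv> in_event M X"

lemma ev_sets: "A \<in> sets (rspace d) \<Longrightarrow> ev A \<in> events"
  using measurable_sets[OF X, of A] by (simp add: in_event_def vimage_def Int_def conj_commute)

lemma component_measurable:
  assumes "j \<in> {1..d}"
  shows "(\<lambda>x. x j) \<in> borel_measurable (rspace d)" "(\<lambda>\<omega>. X \<omega> j) \<in> borel_measurable M"
proof -
  show "(\<lambda>x. x j) \<in> borel_measurable (rspace d)"
    using assms unfolding rspace_def by measurable
  from measurable_compose[OF X this] show "(\<lambda>\<omega>. X \<omega> j) \<in> borel_measurable M" .
qed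

lemma halfspace_sets:
  assumes "j \<in> {1..d}" "A \<in> sets (rspace d)"
  shows "A \<inter> {x. x j < t} \<in> sets (rspace d)" "A \<inter> {x. x j \<ge> t} \<in> sets (rspace d)"
proof -
  have [measurable]: "(\<lambda>x. x j) \<in> borel_measurable (rspace d)"
    by (rule component_measurable) fact
  have "A \<inter> {x. x j < t} = A \<inter> {x\<in>space (rspace d). x j < t}"
    "A \<inter> {x. x j \<ge> t} = A \<inter> {x\<in>space (rspace d). x j \<ge> t}"
    using sets.sets_into_space[OF assms(2)] by auto
  moreover have "{x\<in>space (rspace d). x j < t} \<in> sets (rspace d)"
    "{x\<in>space (rspace d). x j \<ge> t} \<in> sets (rspace d)"
    by measurable
  ultimately show "A \<inter> {x. x j < t} \<in> sets (rspace d)" "A \<inter> {x. x j \<ge> t} \<in> sets (rspace d)"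
    using assms(2) by simp_all
qed

text \<open>A kept cell is not halved, so the geometric decay of the cells survives only because
  such a cell has weighted variance 0.\<close>

lemma wvar_unsplittable:
  assumes A: "A \<in> sets (rspace d)" and "unsplittable d M X Y A"
  shows "wvar M Y (ev A) = 0"
proof -
  let ?U = "uniform_measure M (ev A)"
  consider "prob (ev A) = 0"
    | c where "distr ?U borel Y = return borel c"
    | c where "prob (ev A) > 0" "c \<in> space (rspace d)" "distr ?U (rspace d) X = return (rspace d) c"
    using assms(2) unfolding unsplittable_def by blast
  then show ?thesis
  proof cases
    case 1
    then show ?thesis by (simp add: wvar_def)
  next
    case (2 c)
    have Y': "Y \<in> borel_measurable ?U" by simp
    have int: "(\<integral>\<omega>. f (Y \<omega>) \<partial>?U) = f c" if [measurable]: "f \<in> borel_measurable borel" for f :: "real \<Rightarrow> real"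
      using integral_distr[OF Y', of f] 2 by (simp add: integral_return)
    have "cmean M Y (ev A) = c"
      unfolding cmean_def using int[of "\<lambda>x. x"] by simp
    then have "cvar M Y (ev A) = 0"
      unfolding cvar_def using int[of "\<lambda>x. (x - c)\<^sup>2"] by simp
    then show ?thesis by (simp add: wvar_def)
  next
    case (3 c)
    \<comment> \<open>A point mass at \<open>c\<close> would give conditional probability 1 to the
      event that the first coordinate equals \<open>c 1\<close>, which is null by atomlessness; this
      case is contradictory.\<close>
    have one: "1 \<in> {1..d}" using d by simp
    note [measurable] = component_measurable[OF one] ev_sets[OF A]
    let ?H = "{x\<in>space (rspace d). x 1 = c 1}"
    have H: "?H \<in> sets (rspace d)" and S: "{\<omega>\<in>space M. X \<omega> 1 = c 1} \<in> events"
      by measurable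
    have "1 = measure (return (rspace d) c) ?H"
      using 3 H by (simp add: measure_return)
    also have "\<dots> = measure ?U (X -` ?H \<inter> space ?U)"
      unfolding 3(3)[symmetric] using H by (intro measure_distr) auto
    also have "X -` ?H \<inter> space ?U = {\<omega>\<in>space M. X \<omega> 1 = c 1}"
      using measurable_space[OF X] by auto
    also have "measure ?U \<dots> = prob (ev A \<inter> {\<omega>\<in>space M. X \<omega> 1 = c 1}) / prob (ev A)"
      using 3(1) by (intro measure_uniform_measure) (use S in \<open>simp_all add: emeasure_eq_measure\<close>)
    also have "prob (ev A \<inter> {\<omega>\<in>space M. X \<omega> 1 = c 1}) \<le> prob {\<omega>\<in>space M. X \<omega> 1 = c 1}"
      using S by (intro finite_measure_mono) auto
    also have "\<dots> = 0"
      using atomless one unfolding marginally_atomless_def by blast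
    finally show ?thesis using 3(1) by (simp add: divide_right_mono)
  qed
qed

text \<open>The halving threshold competes in the arg min: its left part carries half, and
  superadditivity leaves at most half for the right part.\<close>

lemma split_objective_le_half:
  assumes A: "A \<in> sets (rspace d)" and j: "j \<in> {1..d}"
    and t: "minimax_split_point d M X Y j A t"
  shows "wvar M Y (ev (A \<inter> {x. x j < t})) \<le> wvar M Y (ev A) / 2"
    "wvar M Y (ev (A \<inter> {x. x j \<ge> t})) \<le> wvar M Y (ev A) / 2"
proof -
  let ?L = "\<lambda>t. ev (A \<inter> {x. x j < t})" and ?R = "\<lambda>t. ev (A \<inter> {x. x j \<ge> t})"
  have obj: "split_objective M X Y j A s = max (wvar M Y (?L s)) (wvar M Y (?R s))" for s
    by (simp add: split_objective_def Let_def wvar_def)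
  have LR: "wvar M Y (?L s) + wvar M Y (?R s) \<le> wvar M Y (ev A)" for s
  proof -
    have "?L s \<union> ?R s = ev A" "?L s \<inter> ?R s = {}" by (auto simp: in_event_def)
    then show ?thesis
      using wvar_split[OF Y Y2, of "?L s" "?R s"] halfspace_sets[OF j A, THEN ev_sets] by simp
  qed
  have nonneg: "0 \<le> wvar M Y (?L s)" "0 \<le> wvar M Y (?R s)" for s
    using halfspace_sets[OF j A] by (auto intro!: wvar_nonneg Y Y2 ev_sets)
  have "split_objective M X Y j A t \<le> wvar M Y (ev A) / 2"
  proof (cases "wvar M Y (ev A) > 0")
    \<comment> \<open>No halving threshold is available here, but superadditivity and nonnegativity
      force both parts to 0.\<close>
    case False
    with LR[of t] nonneg[of t] show ?thesis by (simp add: obj)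
  next
    case True
    obtain a b where A_eq: "A = box_of d a b"
      and min: "is_arg_min (split_objective M X Y j A) (\<lambda>s. a j \<le> ereal s \<and> ereal s < b j) t"
      using t unfolding minimax_split_point_def by blast
    obtain s where "wvar M Y {\<omega>\<in>ev A. X \<omega> j < s} = wvar M Y (ev A) / 2"
      using atomless j
      by (rule_tac halving_threshold[OF Y Y2 ev_sets[OF A] component_measurable(2)[OF j] _ True])
        (auto simp: marginally_atomless_def)
    moreover have "{\<omega>\<in>ev A. X \<omega> j < s} = ?L s" by (auto simp: in_event_def)
    ultimately have s: "wvar M Y (?L s) = wvar M Y (ev A) / 2" by simp
    \<comment> \<open>The threshold must be admissible for this cell. To the left of
      \<open>a j\<close> the left part would be empty, and from \<open>b j\<close> on it would be
      the whole cell; neither carries exactly half of a positive amount.\<close>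
    have "a j \<le> ereal s"
    proof (rule ccontr)
      assume "\<not> a j \<le> ereal s"
      then have "ereal s < a j" by simp
      moreover have "a j \<le> ereal (x j)" if "x \<in> A" for x
        using that j by (auto simp: A_eq box_of_def)
      ultimately have "ereal s < ereal (x j)" if "x \<in> A" for x
        using that by (blast intro: order.strict_trans2)
      then have "\<not> x j < s" if "x \<in> A" for x
        using that by (simp add: not_less less_imp_le)
      then have "?L s = {}" by (auto simp: in_event_def)
      then show False using s True by (simp add: wvar_empty)
    qed
    moreover have "ereal s < b j"
    proof (rule ccontr)
      assume "\<not> ereal s < b j"
      then have "b j \<le> ereal s" by simp
      moreover have "ereal (x j) < b j" if "x \<in> A" for x
        using that j by (auto simp: A_eq box_of_def)
      ultimately have "ereal (x j) < ereal s" if "x \<in> A" for x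
        using that by (blast intro: order.strict_trans2)
      then have "x j < s" if "x \<in> A" for x
        using that by simp
      then have "?L s = ev A" by (auto simp: in_event_def)
      then show False using s True by simp
    qed
    ultimately have "split_objective M X Y j A t \<le> split_objective M X Y j A s"
      using min by (auto simp: is_arg_min_def not_less)
    also have "\<dots> \<le> wvar M Y (ev A) / 2"
      using s LR[of s] by (simp add: obj)
    finally show ?thesis .
  qed
  then show "wvar M Y (?L t) \<le> wvar M Y (ev A) / 2" "wvar M Y (?R t) \<le> wvar M Y (ev A) / 2"
    by (simp_all add: obj)
qed

section \<open>The partitions as finite disjoint measurable covers\<close>

definition children :: "nat \<Rightarrow> ((nat \<Rightarrow> real) set \<Rightarrow> real) \<Rightarrow> (nat \<Rightarrow> real) set \<Rightarrow> (nat \<Rightarrow> real) set set" where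
  "children j \<xi> A = (if unsplittable d M X Y A then {A}
     else {A \<inter> {x. x j < \<xi> A}, A \<inter> {x. x j \<ge> \<xi> A}})"

lemma partition_Suc:
  "\<exists>\<xi>. (\<forall>A\<in>\<pi> k. \<not> unsplittable d M X Y A \<longrightarrow> minimax_split_point d M X Y (1 + k mod d) A (\<xi> A)) \<and>
     \<pi> (Suc k) = (\<Union>A\<in>\<pi> k. children (1 + k mod d) \<xi> A)"
  using partitions unfolding cyclic_minimax_partitions_def minimax_step_def children_def by blast

lemma partition_0: "\<pi> 0 = {space (rspace d)}"
  using partitions unfolding cyclic_minimax_partitions_def by blast

lemma split_coordinate: "1 + k mod d \<in> {1..d}"
  using d by (simp add: Suc_leI)

lemma finite_children: "finite (children j \<xi> A)"
  by (simp add: children_def)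

lemma Union_children: "\<Union>(children j \<xi> A) = A"
  by (auto simp: children_def)

lemma finite_partition: "finite (\<pi> k)"
proof (induction k)
  case (Suc k)
  then show ?case
    using partition_Suc[of k] by (auto simp: finite_children)
qed (simp add: partition_0)

lemma partition_sets: "A \<in> \<pi> k \<Longrightarrow> A \<in> sets (rspace d)"
proof (induction k arbitrary: A)
  case (Suc k)
  obtain \<xi> where "\<pi> (Suc k) = (\<Union>A\<in>\<pi> k. children (1 + k mod d) \<xi> A)"
    using partition_Suc[of k] by blast
  then show ?case
    using Suc halfspace_sets[OF split_coordinate]
    by (auto simp: children_def split: if_splits)
qed (simp add: partition_0)

lemma partition_Union: "\<Union>(\<pi> k) = space (rspace d)"
proof (induction k)
  case (Suc k)
  obtain \<xi> where "\<pi> (Suc k) = (\<Union>A\<in>\<pi> k. children (1 + k mod d) \<xi> A)"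
    using partition_Suc[of k] by blast
  then have "\<Union>(\<pi> (Suc k)) = (\<Union>A\<in>\<pi> k. \<Union>(children (1 + k mod d) \<xi> A))" by blast
  then show ?case using Suc by (simp add: Union_children)
qed (simp add: partition_0)

lemma partition_disjoint: "disjoint (\<pi> k)"
proof (induction k)
  case (Suc k)
  obtain \<xi> where \<xi>: "\<pi> (Suc k) = (\<Union>A\<in>\<pi> k. children (1 + k mod d) \<xi> A)"
    using partition_Suc[of k] by blast
  show ?case
  proof (rule disjointI)
    fix a b assume "a \<in> \<pi> (Suc k)" "b \<in> \<pi> (Suc k)" and ne: "a \<noteq> b"
    then obtain A B where AB: "A \<in> \<pi> k" "B \<in> \<pi> k" "a \<in> children (1 + k mod d) \<xi> A" "b \<in> children (1 + k mod d) \<xi> B"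
      using \<xi> by auto
    show "a \<inter> b = {}"
    proof (cases "A = B")
      case True
      then show ?thesis using AB(3,4) ne by (auto simp: children_def split: if_splits)
    next
      case False
      then have "A \<inter> B = {}" using disjointD[OF Suc AB(1,2)] by simp
      moreover have "a \<subseteq> A" "b \<subseteq> B" using AB(3,4) Union_children by blast+
      ultimately show ?thesis by blast
    qed
  qed
qed (simp add: partition_0)

lemma sum_partition_integral:
  fixes f :: "'w \<Rightarrow> real"
  assumes f: "integrable M f"
  shows "(\<Sum>A\<in>\<pi> k. \<integral>\<omega>. indicator (ev A) \<omega> * f \<omega> \<partial>M) = (\<integral>\<omega>. f \<omega> \<partial>M)"
proof -
  have int: "integrable M (\<lambda>\<omega>. indicator (ev A) \<omega> * f \<omega>)" if "A \<in> \<pi> k" for A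
    using integrable_real_mult_indicator[OF ev_sets[OF partition_sets[OF that]] f] by (simp add: mult.commute)
  have "(\<Sum>A\<in>\<pi> k. \<integral>\<omega>. indicator (ev A) \<omega> * f \<omega> \<partial>M)
      = (\<integral>\<omega>. (\<Sum>A\<in>\<pi> k. indicator (ev A) \<omega> * f \<omega>) \<partial>M)"
    using int by (rule Bochner_Integration.integral_sum[symmetric])
  also have "\<dots> = (\<integral>\<omega>. f \<omega> \<partial>M)"
  proof (rule Bochner_Integration.integral_cong[OF refl])
    fix \<omega> assume \<omega>: "\<omega> \<in> space M"
    then have "X \<omega> \<in> \<Union>(\<pi> k)" using measurable_space[OF X] by (simp add: partition_Union)
    then obtain A where A: "A \<in> \<pi> k" "X \<omega> \<in> A" by blast
    have "indicator (ev B) \<omega> = (if B = A then 1 else 0 :: real)" if "B \<in> \<pi> k" for B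
      using disjointD[OF partition_disjoint that A(1)] A \<omega> by (auto simp: in_event_def indicator_def)
    then have "(\<Sum>A\<in>\<pi> k. indicator (ev A) \<omega> * f \<omega>) = (\<Sum>B\<in>\<pi> k. if B = A then f \<omega> else 0)"
      by (intro sum.cong) auto
    then show "(\<Sum>A\<in>\<pi> k. indicator (ev A) \<omega> * f \<omega>) = f \<omega>"
      using A(1) finite_partition by simp
  qed
  finally show ?thesis .
qed

lemma sum_partition_prob: "(\<Sum>A\<in>\<pi> k. prob (ev A)) = 1"
  using sum_partition_integral[of "\<lambda>_. 1" k] ev_sets partition_sets
  by (simp add: prob_space)

text \<open>Exactly one cell contains \<open>X \<omega>\<close>, so the squared error agrees on the
  whole space with a finite sum of integrable functions, one for each cell.\<close>

lemma mean_square_error: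
  assumes "associated_process M X Y \<pi> Z"
  shows "(\<integral>\<omega>. (Y \<omega> - Z k \<omega>)\<^sup>2 \<partial>M) = (\<Sum>A\<in>\<pi> k. wvar M Y (ev A))"
proof -
  have "(\<integral>\<omega>. (Y \<omega> - Z k \<omega>)\<^sup>2 \<partial>M)
      = (\<integral>\<omega>. (\<Sum>A\<in>\<pi> k. indicator (ev A) \<omega> * (Y \<omega> - cmean M Y (ev A))\<^sup>2) \<partial>M)"
  proof (rule Bochner_Integration.integral_cong[OF refl])
    fix \<omega> assume \<omega>: "\<omega> \<in> space M"
    then have "X \<omega> \<in> \<Union>(\<pi> k)" using measurable_space[OF X] by (simp add: partition_Union)
    then obtain A where A: "A \<in> \<pi> k" "X \<omega> \<in> A" by blast
    then have Z: "Z k \<omega> = cmean M Y (ev A)"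
      using assms \<omega> by (auto simp: associated_process_def in_event_def)
    have "indicator (ev B) \<omega> = (if B = A then 1 else 0 :: real)" if "B \<in> \<pi> k" for B
      using disjointD[OF partition_disjoint that A(1)] A \<omega> by (auto simp: in_event_def indicator_def)
    then have "(\<Sum>A\<in>\<pi> k. indicator (ev A) \<omega> * (Y \<omega> - cmean M Y (ev A))\<^sup>2)
        = (\<Sum>B\<in>\<pi> k. if B = A then (Y \<omega> - Z k \<omega>)\<^sup>2 else 0)"
      by (intro sum.cong) (auto simp: Z)
    then show "(Y \<omega> - Z k \<omega>)\<^sup>2 = (\<Sum>A\<in>\<pi> k. indicator (ev A) \<omega> * (Y \<omega> - cmean M Y (ev A))\<^sup>2)"
      using A(1) finite_partition by simp
  qed
  also have "\<dots> = (\<Sum>A\<in>\<pi> k. \<integral>\<omega>. indicator (ev A) \<omega> * (Y \<omega> - cmean M Y (ev A))\<^sup>2 \<partial>M)"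
    by (intro Bochner_Integration.integral_sum integrable_indicator_Y Y Y2 ev_sets partition_sets)
  also have "\<dots> = (\<Sum>A\<in>\<pi> k. wvar M Y (ev A))"
    by (intro sum.cong refl wvar_eq_integral[symmetric] Y Y2 ev_sets partition_sets)
  finally show ?thesis .
qed

lemma wvar_partition_le:
  "A \<in> \<pi> k \<Longrightarrow> wvar M Y (ev A) \<le> wvar M Y (space M) / 2 ^ k"
proof (induction k arbitrary: A)
  case 0
  have "ev (space (rspace d)) = space M"
    using measurable_space[OF X] by (auto simp: in_event_def)
  then show ?case using 0 by (simp add: partition_0)
next
  case (Suc k)
  obtain \<xi> where \<xi>:
    "\<And>A. A \<in> \<pi> k \<Longrightarrow> \<not> unsplittable d M X Y A \<Longrightarrow> minimax_split_point d M X Y (1 + k mod d) A (\<xi> A)"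
    "\<pi> (Suc k) = (\<Union>A\<in>\<pi> k. children (1 + k mod d) \<xi> A)"
    using partition_Suc[of k] by blast
  then obtain B where B: "B \<in> \<pi> k" "A \<in> children (1 + k mod d) \<xi> B"
    using Suc.prems by blast
  show ?case
  proof (cases "unsplittable d M X Y B")
    case True
    \<comment> \<open>The cell is inherited unchanged, and the bound holds because its weighted
      variance is already 0.\<close>
    with B have "wvar M Y (ev A) = 0"
      using wvar_unsplittable[OF partition_sets[OF B(1)]] by (simp add: children_def)
    then show ?thesis using wvar_nonneg[OF Y Y2, of "space M"] by simp
  next
    case False
    then have "wvar M Y (ev A) \<le> wvar M Y (ev B) / 2"
      using split_objective_le_half[OF partition_sets[OF B(1)] split_coordinate \<xi>(1)[OF B(1) False]] B(2)
      by (auto simp: children_def)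
    also have "\<dots> \<le> wvar M Y (space M) / 2 ^ k / 2"
      using Suc.IH[OF B(1)] by simp
    finally show ?thesis by simp
  qed
qed

section \<open>Growth of the summed oscillations along the partitions\<close>

lemma sum_children_le:
  fixes f :: "(nat \<Rightarrow> real) set \<Rightarrow> real"
  assumes "\<And>A. 0 \<le> f A"
    and "\<And>A. A \<in> \<pi> k \<Longrightarrow> f A \<le> c * f A"
    and "\<And>A t. A \<in> \<pi> k \<Longrightarrow>
      f (A \<inter> {x. x (1 + k mod d) < t}) + f (A \<inter> {x. x (1 + k mod d) \<ge> t}) \<le> c * f A"
  shows "sum f (\<pi> (Suc k)) \<le> c * sum f (\<pi> k)"
proof -
  obtain \<xi> where \<xi>: "\<pi> (Suc k) = (\<Union>A\<in>\<pi> k. children (1 + k mod d) \<xi> A)"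
    using partition_Suc[of k] by blast
  have "sum f (\<pi> (Suc k)) \<le> (\<Sum>A\<in>\<pi> k. sum f (children (1 + k mod d) \<xi> A))"
    unfolding \<xi> by (intro sum_UN_le finite_partition finite_children assms(1))
  also have "\<dots> \<le> (\<Sum>A\<in>\<pi> k. c * f A)"
  proof (rule sum_mono)
    fix A assume A: "A \<in> \<pi> k"
    \<comment> \<open>The second hypothesis covers a kept cell, the third a cell cut at whatever
      threshold was chosen.\<close>
    show "sum f (children (1 + k mod d) \<xi> A) \<le> c * f A"
      unfolding children_def
      using assms(2)[OF A] sum_pair_le[of f, OF assms(1)] assms(3)[OF A, of "\<xi> A"]
      by (auto intro: order_trans)
  qed
  finally show ?thesis by (simp add: sum_distrib_left)
qed

text \<open>Monotonicity of \<open>F\<close> is essential: it maps the two halves of a cut along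
  \<open>j\<close> to ordered sets, whose diameters add up to at most that of the cell. For a
  general function a cut could double the sum.\<close>

lemma sum_diameter_partition_le:
  fixes F :: "real \<Rightarrow> real"
  assumes mono: "mono F" and osc: "\<And>x y. F y - F x \<le> T" and j: "j \<in> {1..d}"
  shows "(\<Sum>A\<in>\<pi> k. diameter ((\<lambda>x. F (x j)) ` A)) \<le> 2 ^ k / 2 ^ (k div d) * T"
proof -
  define D where "D A = diameter ((\<lambda>x. F (x j)) ` A)" for A :: "(nat \<Rightarrow> real) set"
  have bdd: "bounded ((\<lambda>x. F (x j)) ` A)" for A
  proof (rule bounded_subset[OF bounded_closed_interval])
    show "(\<lambda>x. F (x j)) ` A \<subseteq> {F 0 - T..F 0 + T}"
      using osc[of _ 0] osc[of 0] by (auto simp: algebra_simps)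
  qed
  have D0: "0 \<le> D A" for A
    unfolding D_def by (rule diameter_ge_0[OF bdd])
  have T0: "0 \<le> T" using osc[of 0 0] by simp
  have mono_D: "D B \<le> D A" if "B \<subseteq> A" for A B
    unfolding D_def using that by (intro diameter_subset bdd) auto
  have split_D: "D (A \<inter> {x. x j < t}) + D (A \<inter> {x. x j \<ge> t}) \<le> D A" for A t
  proof -
    have "D (A \<inter> {x. x j < t}) + D (A \<inter> {x. x j \<ge> t})
        \<le> diameter ((\<lambda>x. F (x j)) ` (A \<inter> {x. x j < t}) \<union> (\<lambda>x. F (x j)) ` (A \<inter> {x. x j \<ge> t}))"
      unfolding D_def
      by (rule diameter_add_le) (use bdd in \<open>auto simp: image_Un[symmetric] intro!: monoD[OF mono]\<close>)
    also have "(\<lambda>x. F (x j)) ` (A \<inter> {x. x j < t}) \<union> (\<lambda>x. F (x j)) ` (A \<inter> {x. x j \<ge> t})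
        = (\<lambda>x. F (x j)) ` A"
      by force
    finally show ?thesis unfolding D_def .
  qed
  \<comment> \<open>the number of splits along coordinate \<open>j\<close> among the first \<open>k\<close>\<close>
  define n where "n k = card {i. i < k \<and> i mod d = j - 1}" for k
  have n_Suc: "n (Suc k) = n k + (if 1 + k mod d = j then 1 else 0)" for k
  proof -
    have "{i. i < Suc k \<and> i mod d = j - 1}
        = (if 1 + k mod d = j then insert k {i. i < k \<and> i mod d = j - 1} else {i. i < k \<and> i mod d = j - 1})"
      using j by (auto simp: less_Suc_eq)
    then show ?thesis by (simp add: n_def)
  qed
  have "sum D (\<pi> k) \<le> 2 ^ k / 2 ^ n k * T"
  proof (induction k)
    case 0
    have "D (space (rspace d)) \<le> T"
      unfolding D_def using osc T0
      by (intro diameter_le) (auto simp: abs_le_iff algebra_simps)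
    then show ?case by (simp add: partition_0 n_def)
  next
    case (Suc k)
    show ?case
    proof (cases "1 + k mod d = j")
      case True
      have "sum D (\<pi> (Suc k)) \<le> 1 * sum D (\<pi> k)"
        using split_D True by (intro sum_children_le D0) auto
      also have "\<dots> \<le> 2 ^ k / 2 ^ n k * T" using Suc by simp
      finally show ?thesis using True by (simp add: n_Suc)
    next
      case False
      have "sum D (\<pi> (Suc k)) \<le> 2 * sum D (\<pi> k)"
      proof (rule sum_children_le[OF D0])
        show "D A \<le> 2 * D A" for A using D0[of A] by simp
        show "D (A \<inter> {x. x (1 + k mod d) < t}) + D (A \<inter> {x. x (1 + k mod d) \<ge> t}) \<le> 2 * D A" for A t
          using mono_D[of "A \<inter> {x. x (1 + k mod d) < t}" A] mono_D[of "A \<inter> {x. x (1 + k mod d) \<ge> t}" A]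
          by auto
      qed
      also have "\<dots> \<le> 2 * (2 ^ k / 2 ^ n k * T)" using Suc by simp
      finally show ?thesis using False by (simp add: n_Suc)
    qed
  qed
  also have "k div d \<le> n k"
  proof -
    \<comment> \<open>Each completed cycle \<open>q\<close> contributes one split along
      \<open>j\<close>, at time \<open>q * d + (j - 1)\<close>; steps count from 0 and coordinates
      from 1.\<close>
    have "(\<lambda>q. q * d + (j - 1)) ` {..<k div d} \<subseteq> {i. i < k \<and> i mod d = j - 1}"
    proof (rule image_subsetI)
      fix q assume "q \<in> {..<k div d}"
      then have "Suc q * d \<le> k div d * d" by (intro mult_le_mono1) auto
      then have "Suc q * d \<le> k" by (meson div_times_less_eq_dividend order_trans)
      then have "q * d + (j - 1) < k" using j by auto
      moreover have "(q * d + (j - 1)) mod d = j - 1"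
        using j by (subst mod_mult_self3) auto
      ultimately show "q * d + (j - 1) \<in> {i. i < k \<and> i mod d = j - 1}" by simp
    qed
    then have "card ((\<lambda>q. q * d + (j - 1)) ` {..<k div d}) \<le> n k"
      unfolding n_def by (intro card_mono) auto
    moreover have "inj_on (\<lambda>q. q * d + (j - 1)) {..<k div d}"
      using d by (auto simp: inj_on_def)
    ultimately show ?thesis by (simp add: card_image)
  qed
  then have "2 ^ k / 2 ^ n k * T \<le> 2 ^ k / 2 ^ (k div d) * T"
    using T0 by (intro mult_right_mono divide_left_mono power_increasing) auto
  finally show ?thesis unfolding D_def .
qed

end

subsection \<open>The convergence rate\<close>

text \<open>The difference of the two sides is
  \<open>(\<delta> * a - b)\<^sup>2 / \<delta>\<close>.\<close>

lemma square_add_le: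
  fixes a b \<delta> :: real
  assumes "0 < \<delta>"
  shows "(a + b)\<^sup>2 \<le> (1 + \<delta>) * a\<^sup>2 + (1 + inverse \<delta>) * b\<^sup>2"
proof -
  have "0 \<le> (\<delta> * a - b)\<^sup>2 / \<delta>" using assms by simp
  then show ?thesis
    using assms by (simp add: field_simps power2_eq_square)
qed

text \<open>The choice \<open>s = B powr (1/3)\<close> minimises
  \<open>s\<^sup>2 / 3 + 2 * B / (3 * s)\<close>, with value \<open>B powr (2/3)\<close>. The factor
  \<open>N\<close>, later \<open>2 ^ k\<close>, then cancels, and only the number \<open>K\<close>
  of full cycles remains.\<close>

lemma minimax_rate_bound:
  fixes V N B c t :: real and K :: nat
  assumes "0 \<le> V" "0 < N" "0 < c" "0 < t" and B: "B = N / 2 ^ K * t"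
    and s: "s = B powr (1/3)"
  shows "(V / N) powr (2/3) * c powr (1/3) * (s\<^sup>2 / 3 + 2 * B / (3 * s))
    \<le> 2 powr (- 2 * real K / 3) * (2/3 * V + c * t\<^sup>2 / 3)"
proof (cases "V = 0")
  case True
  then show ?thesis using assms by simp
next
  case False
  have B0: "0 < B" using assms by simp
  have "B powr 1 / B powr (1/3) = B powr (2/3)"
    by (subst powr_diff[symmetric]) simp
  then have "B / s = B powr (2/3)"
    using B0 by (simp add: s)
  moreover have "s\<^sup>2 = B powr (2/3)"
    by (simp add: s power2_eq_square flip: powr_add)
  moreover have "s\<^sup>2 / 3 + 2 * B / (3 * s) = s\<^sup>2 / 3 + 2/3 * (B / s)"
    by simp
  ultimately have "(V / N) powr (2/3) * c powr (1/3) * (s\<^sup>2 / 3 + 2 * B / (3 * s))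
      = (V / N) powr (2/3) * c powr (1/3) * B powr (2/3)"
    by simp
  also have "\<dots> = (2 ^ K) powr (- (2/3)) * (V powr (2/3) * (c * t\<^sup>2) powr (1/3))"
  proof -
    have "(t * t) powr (1/3) = t powr (2/3)"
      using assms by (simp add: powr_mult flip: powr_add)
    then show ?thesis
      using assms
      by (simp add: B powr_mult powr_divide powr_minus_divide power2_eq_square)
  qed
  also have "(2 ^ K) powr (- (2/3)) = (2 :: real) powr (- 2 * real K / 3)"
    by (simp add: powr_powr mult.commute flip: powr_realpow)
  \<comment> \<open>Young's inequality makes the bound linear in \<open>V\<close>, so that an
    estimate of \<open>V\<close> can be inserted afterwards.\<close>
  also have "V powr (2/3) * (c * t\<^sup>2) powr (1/3) \<le> 2/3 * V + 1/3 * (c * t\<^sup>2)"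
    using assms False by (intro Youngs_inequality_0) auto
  finally show ?thesis by simp
qed

context cyclic_minimax
begin

text \<open>The variance is estimated with the midpoint of the range of \<open>g\<close> on
  \<open>A\<close> as centre, and \<open>Y - c\<close> is split pointwise into \<open>Y - g\<close>
  and \<open>g - c\<close>.\<close>

lemma wvar_le_oscillation:
  fixes g :: "(nat \<Rightarrow> real) \<Rightarrow> real"
  assumes A: "A \<in> sets (rspace d)" and \<delta>: "0 < \<delta>"
    and osc: "\<And>x y. x \<in> A \<Longrightarrow> y \<in> A \<Longrightarrow> \<bar>g x - g y\<bar> \<le> D"
    and int: "integrable M (\<lambda>\<omega>. (Y \<omega> - g (X \<omega>))\<^sup>2)"
  shows "wvar M Y (ev A) \<le> (1 + \<delta>) * (\<integral>\<omega>. indicator (ev A) \<omega> * (Y \<omega> - g (X \<omega>))\<^sup>2 \<partial>M)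
    + (1 + inverse \<delta>) / 4 * prob (ev A) * D\<^sup>2"
proof -
  note E [measurable] = ev_sets[OF A]
  obtain c where c: "\<And>x. x \<in> A \<Longrightarrow> \<bar>g x - c\<bar> \<le> D / 2"
    using midpoint_of_oscillation[of A g D, OF osc] by blast
  have int': "integrable M (\<lambda>\<omega>. indicator (ev A) \<omega> * (Y \<omega> - g (X \<omega>))\<^sup>2)"
    using integrable_real_mult_indicator[OF E int] by (simp add: mult.commute)
  have indE: "integrable M (indicator (ev A) :: 'w \<Rightarrow> real)"
    by (simp add: emeasure_eq_measure)
  have "wvar M Y (ev A) \<le> (\<integral>\<omega>. indicator (ev A) \<omega> * (Y \<omega> - c)\<^sup>2 \<partial>M)"
    by (rule wvar_le[OF Y Y2 E])
  also have "\<dots> \<le> (\<integral>\<omega>. (1 + \<delta>) * (indicator (ev A) \<omega> * (Y \<omega> - g (X \<omega>))\<^sup>2)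
      + (1 + inverse \<delta>) / 4 * D\<^sup>2 * indicator (ev A) \<omega> \<partial>M)"
  proof (rule integral_mono)
    show "integrable M (\<lambda>\<omega>. indicator (ev A) \<omega> * (Y \<omega> - c)\<^sup>2)"
      by (rule integrable_indicator_Y(3)[OF Y Y2 E])
    show "integrable M (\<lambda>\<omega>. (1 + \<delta>) * (indicator (ev A) \<omega> * (Y \<omega> - g (X \<omega>))\<^sup>2)
        + (1 + inverse \<delta>) / 4 * D\<^sup>2 * indicator (ev A) \<omega>)"
      using int' indE by simp
    fix \<omega>
    have "(Y \<omega> - c)\<^sup>2 \<le> (1 + \<delta>) * (Y \<omega> - g (X \<omega>))\<^sup>2 + (1 + inverse \<delta>) / 4 * D\<^sup>2" if "\<omega> \<in> ev A"
    proof -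
      have "\<bar>g (X \<omega>) - c\<bar>\<^sup>2 \<le> (D / 2)\<^sup>2"
        using c[of "X \<omega>"] that by (intro power_mono) (auto simp: in_event_def)
      then have "(1 + inverse \<delta>) * (g (X \<omega>) - c)\<^sup>2 \<le> (1 + inverse \<delta>) * (D / 2)\<^sup>2"
        using \<delta> by (intro mult_left_mono) auto
      with square_add_le[OF \<delta>, of "Y \<omega> - g (X \<omega>)" "g (X \<omega>) - c"] show ?thesis
        by (simp add: power_divide)
    qed
    then show "indicator (ev A) \<omega> * (Y \<omega> - c)\<^sup>2 \<le> (1 + \<delta>) * (indicator (ev A) \<omega> * (Y \<omega> - g (X \<omega>))\<^sup>2)
        + (1 + inverse \<delta>) / 4 * D\<^sup>2 * indicator (ev A) \<omega>"
      by (simp split: split_indicator)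
  qed
  also have "\<dots> = (1 + \<delta>) * (\<integral>\<omega>. indicator (ev A) \<omega> * (Y \<omega> - g (X \<omega>))\<^sup>2 \<partial>M)
      + (1 + inverse \<delta>) / 4 * prob (ev A) * D\<^sup>2"
    using int' indE by simp
  finally show ?thesis .
qed

text \<open>Finite total variation makes each \<open>h i\<close> bounded. Without integrability the
  integral of the squared error would default to 0.\<close>

lemma integrable_square_error:
  assumes rep: "additive_rep d g h"
  shows "integrable M (\<lambda>\<omega>. (Y \<omega> - g (X \<omega>))\<^sup>2)"
proof -
  define G where "G \<omega> = (\<Sum>i\<in>{1..d}. h i (X \<omega> i))" for \<omega>
  have bv: "bounded_variation (h i)" if "i \<in> {1..d}" for i
    using rep that by (simp add: additive_rep_def)
  have [measurable]: "G \<in> borel_measurable M"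
    unfolding G_def
    by (intro borel_measurable_sum measurable_compose[OF component_measurable(2)] bounded_variation_borel_measurable bv)
  have "\<bar>h i x\<bar> \<le> \<bar>h i 0\<bar> + total_variation (h i)" if i: "i \<in> {1..d}" for i x
  proof -
    obtain F where F: "\<And>x y. x \<le> y \<Longrightarrow> \<bar>h i y - h i x\<bar> \<le> F y - F x"
      "\<And>x y. F y - F x \<le> total_variation (h i)"
      using variation_function[OF bv[OF i]] by blast
    show ?thesis
      using F(1)[of 0 x] F(1)[of x 0] F(2)[of x 0] F(2)[of 0 x] by linarith
  qed
  then have "\<bar>G \<omega>\<bar> \<le> (\<Sum>i\<in>{1..d}. \<bar>h i 0\<bar> + total_variation (h i))" for \<omega>
    unfolding G_def by (intro order_trans[OF sum_abs] sum_mono) auto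
  then have "integrable M (\<lambda>\<omega>. (G \<omega>)\<^sup>2)"
    by (intro integrable_const_bound[of _ "(\<Sum>i\<in>{1..d}. \<bar>h i 0\<bar> + total_variation (h i))\<^sup>2"])
      (auto simp flip: abs_le_square_iff intro!: AE_I2 order_trans[OF _ abs_ge_self])
  then have "integrable M (\<lambda>\<omega>. (Y \<omega> - G \<omega>)\<^sup>2)"
    by (intro integrable_square_diff Y2) measurable
  moreover have "g (X \<omega>) = G \<omega>" if "\<omega> \<in> space M" for \<omega>
    using rep measurable_space[OF X that] by (simp add: additive_rep_def G_def)
  ultimately show ?thesis
    by (simp cong: Bochner_Integration.integrable_cong)
qed

text \<open>The bound uses a strict majorant-friendly parameter \<open>t\<close> in place of the
  total variation: \<open>t\<close> is positive even if the variation is 0, which keeps the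
  interpolation parameter \<open>s\<close> positive.\<close>

lemma sum_wvar_partition_le:
  assumes rep: "additive_rep d g h" and \<delta>: "0 < \<delta>" and t: "0 < t" "(\<Sum>i\<in>{1..d}. total_variation (h i)) \<le> t"
  defines "\<epsilon> \<equiv> \<integral>\<omega>. (Y \<omega> - g (X \<omega>))\<^sup>2 \<partial>M" and "c \<equiv> (1 + inverse \<delta>) / 4"
  shows "(\<Sum>A\<in>\<pi> k. wvar M Y (ev A))
    \<le> (1 + \<delta>) * \<epsilon> + 2 powr (- 2 * real (k div d) / 3) * (2/3 * (1 + \<delta>) * \<epsilon> + c * t\<^sup>2)"
proof -
  have c0: "0 < c" using \<delta> by (simp add: c_def add_pos_pos)
  note int = integrable_square_error[OF rep]
  have "\<exists>F. \<forall>i\<in>{1..d}. (\<forall>x y. x \<le> y \<longrightarrow> \<bar>h i y - h i x\<bar> \<le> F i y - F i x)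
      \<and> (\<forall>x y. F i y - F i x \<le> total_variation (h i))"
    using rep by (intro bchoice ballI variation_function) (simp add: additive_rep_def)
  then obtain F where F: "\<And>i x y. i \<in> {1..d} \<Longrightarrow> x \<le> y \<Longrightarrow> \<bar>h i y - h i x\<bar> \<le> F i y - F i x"
    and FT: "\<And>i x y. i \<in> {1..d} \<Longrightarrow> F i y - F i x \<le> total_variation (h i)"
    by blast
  have mono: "mono (F i)" if "i \<in> {1..d}" for i
    using order_trans[OF abs_ge_zero F[OF that]] by (simp add: mono_def)
  have hF: "\<bar>h i x - h i y\<bar> \<le> \<bar>F i x - F i y\<bar>" if "i \<in> {1..d}" for i x y
    using F[OF that, of x y] F[OF that, of y x] by linarith
  have bdd: "bounded ((\<lambda>x. F i (x i)) ` A)" if "i \<in> {1..d}" for i and A :: "(nat \<Rightarrow> real) set"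
  proof (rule bounded_subset[OF bounded_closed_interval])
    show "(\<lambda>x. F i (x i)) ` A \<subseteq> {F i 0 - total_variation (h i)..F i 0 + total_variation (h i)}"
      using FT[OF that, of _ 0] FT[OF that, of 0] by (auto simp: algebra_simps)
  qed
  \<comment> \<open>Measured through the variation functions \<open>F i\<close>; this dominates the
    oscillation of \<open>g\<close> on a cell and obeys the summation bound for monotone
    functions.\<close>
  define osc where "osc A = (\<Sum>i\<in>{1..d}. diameter ((\<lambda>x. F i (x i)) ` A))" for A
  have osc0: "0 \<le> osc A" for A
    unfolding osc_def by (intro sum_nonneg diameter_ge_0 bdd)
  have g_diff: "\<bar>g x - g y\<bar> \<le> (\<Sum>i\<in>{1..d}. \<bar>F i (x i) - F i (y i)\<bar>)"
    if "x \<in> space (rspace d)" "y \<in> space (rspace d)" for x y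
  proof -
    have "g x - g y = (\<Sum>i\<in>{1..d}. h i (x i) - h i (y i))"
      using rep that by (simp add: additive_rep_def sum_subtractf)
    also have "\<bar>\<dots>\<bar> \<le> (\<Sum>i\<in>{1..d}. \<bar>F i (x i) - F i (y i)\<bar>)"
      by (intro order_trans[OF sum_abs] sum_mono hF)
    finally show ?thesis .
  qed
  have g_osc: "\<bar>g x - g y\<bar> \<le> osc A" if "A \<in> sets (rspace d)" "x \<in> A" "y \<in> A" for A x y
  proof -
    have "x \<in> space (rspace d)" "y \<in> space (rspace d)"
      using sets.sets_into_space[OF that(1)] that(2,3) by auto
    from g_diff[OF this] show ?thesis
      unfolding osc_def
    proof (rule order_trans, intro sum_mono)
      fix i assume "i \<in> {1..d}"
      from diameter_bounded_bound[OF bdd[OF this], OF imageI[OF that(2)] imageI[OF that(3)]]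
      show "\<bar>F i (x i) - F i (y i)\<bar> \<le> diameter ((\<lambda>x. F i (x i)) ` A)"
        by (simp add: dist_real_def)
    qed
  qed
  have g_osc_space: "\<bar>g x - g y\<bar> \<le> t" if "x \<in> space (rspace d)" "y \<in> space (rspace d)" for x y
  proof -
    have "(\<Sum>i\<in>{1..d}. \<bar>F i (x i) - F i (y i)\<bar>) \<le> (\<Sum>i\<in>{1..d}. total_variation (h i))"
      using FT by (intro sum_mono) (simp add: abs_le_iff)
    with g_diff[OF that] t(2) show ?thesis by simp
  qed
  define V where "V = wvar M Y (space M)"
  have V0: "0 \<le> V"
    unfolding V_def by (intro wvar_nonneg Y Y2) simp
  have "ev (space (rspace d)) = space M"
    using measurable_space[OF X] by (auto simp: in_event_def)
  moreover have "(\<integral>\<omega>. indicator (space M) \<omega> * (Y \<omega> - g (X \<omega>))\<^sup>2 \<partial>M) = \<epsilon>"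
    unfolding \<epsilon>_def by (intro Bochner_Integration.integral_cong) auto
  \<comment> \<open>The oscillation estimate on the whole space bounds the total variance, since
    \<open>g\<close> varies there by at most \<open>t\<close>.\<close>
  moreover have "wvar M Y (ev (space (rspace d)))
      \<le> (1 + \<delta>) * (\<integral>\<omega>. indicator (ev (space (rspace d))) \<omega> * (Y \<omega> - g (X \<omega>))\<^sup>2 \<partial>M)
        + c * prob (ev (space (rspace d))) * t\<^sup>2"
    unfolding c_def by (rule wvar_le_oscillation[OF sets.top \<delta> g_osc_space int])
  ultimately have V: "V \<le> (1 + \<delta>) * \<epsilon> + c * t\<^sup>2"
    by (simp only: V_def prob_space mult_1_right)
  define B where "B = 2 ^ k / 2 ^ (k div d) * t"
  define s where "s = B powr (1/3)"
  have B: "0 < B" and s: "0 < s"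
    using t by (simp_all add: B_def s_def)
  have "(\<Sum>A\<in>\<pi> k. osc A) = (\<Sum>i\<in>{1..d}. \<Sum>A\<in>\<pi> k. diameter ((\<lambda>x. F i (x i)) ` A))"
    unfolding osc_def by (rule sum.swap)
  also have "\<dots> \<le> (\<Sum>i\<in>{1..d}. 2 ^ k / 2 ^ (k div d) * total_variation (h i))"
    using mono FT by (intro sum_mono sum_diameter_partition_le)
  also have "\<dots> = 2 ^ k / 2 ^ (k div d) * (\<Sum>i\<in>{1..d}. total_variation (h i))"
    by (rule sum_distrib_left[symmetric])
  also have "\<dots> \<le> B"
    unfolding B_def using t(2) by (rule mult_left_mono) simp
  finally have sum_osc: "(\<Sum>A\<in>\<pi> k. osc A) \<le> B" .
  define e where "e A = (\<integral>\<omega>. indicator (ev A) \<omega> * (Y \<omega> - g (X \<omega>))\<^sup>2 \<partial>M)" for A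
  define C where "C = (V / 2 ^ k) powr (2/3) * c powr (1/3)"
  have C0: "0 \<le> C" by (simp add: C_def)
  have "wvar M Y (ev A) \<le> (1 + \<delta>) * e A + C * (prob (ev A) * s\<^sup>2 / 3 + 2 * osc A / (3 * s))"
    if A: "A \<in> \<pi> k" for A
  proof -
    note S = partition_sets[OF A]
    have "wvar M Y (ev A) \<le> (1 + \<delta>) * e A + c * prob (ev A) * (osc A)\<^sup>2"
      unfolding e_def c_def by (rule wvar_le_oscillation[OF S \<delta> g_osc[OF S] int])
    moreover have "0 \<le> (1 + \<delta>) * e A"
      using \<delta> by (simp add: e_def)
    moreover have "wvar M Y (ev A) \<le> V / 2 ^ k"
      unfolding V_def by (rule wvar_partition_le[OF A])
    \<comment> \<open>The approximation error is nonnegative, so it may also be added to the bound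
      \<open>V / 2 ^ k\<close>.\<close>
    ultimately have "wvar M Y (ev A) \<le> (1 + \<delta>) * e A + min (c * prob (ev A) * (osc A)\<^sup>2) (V / 2 ^ k)"
      by (simp add: min_def)
    also have "min (c * prob (ev A) * (osc A)\<^sup>2) (V / 2 ^ k)
        \<le> C * (prob (ev A) * s\<^sup>2 / 3 + 2 * osc A / (3 * s))"
      unfolding C_def using V0 c0 s osc0 by (intro min_le_interpolation) auto
    finally show ?thesis by simp
  qed
  then have "(\<Sum>A\<in>\<pi> k. wvar M Y (ev A))
      \<le> (\<Sum>A\<in>\<pi> k. (1 + \<delta>) * e A + C * (prob (ev A) * s\<^sup>2 / 3 + 2 * osc A / (3 * s)))"
    by (rule sum_mono)
  also have "\<dots> = (1 + \<delta>) * (\<Sum>A\<in>\<pi> k. e A)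
      + C * ((\<Sum>A\<in>\<pi> k. prob (ev A)) * s\<^sup>2 / 3 + 2 * (\<Sum>A\<in>\<pi> k. osc A) / (3 * s))"
    by (simp add: sum.distrib distrib_left sum_distrib_left sum_distrib_right sum_divide_distrib)
  also have "\<dots> = (1 + \<delta>) * \<epsilon> + C * (s\<^sup>2 / 3 + 2 * (\<Sum>A\<in>\<pi> k. osc A) / (3 * s))"
    using sum_partition_integral[OF int] by (simp add: e_def \<epsilon>_def sum_partition_prob)
  also have "\<dots> \<le> (1 + \<delta>) * \<epsilon> + C * (s\<^sup>2 / 3 + 2 * B / (3 * s))"
    using sum_osc s C0 by (intro add_left_mono mult_left_mono divide_right_mono) auto
  also have "\<dots> \<le> (1 + \<delta>) * \<epsilon> + 2 powr (- 2 * real (k div d) / 3) * (2/3 * V + c * t\<^sup>2 / 3)"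
    unfolding C_def using V0 c0 t by (intro add_left_mono minimax_rate_bound B_def s_def) auto
  also have "\<dots> \<le> (1 + \<delta>) * \<epsilon> + 2 powr (- 2 * real (k div d) / 3) * (2/3 * (1 + \<delta>) * \<epsilon> + c * t\<^sup>2)"
    \<comment> \<open>Two thirds of the \<open>c * t\<^sup>2\<close> in the bound for
      \<open>V\<close> join the third already present.\<close>
    using V by (intro add_left_mono mult_left_mono) (auto simp: field_simps)
  finally show ?thesis .
qed

end

section \<open>Comparison of constants and passage to the infimum\<close>

lemma rate_constants_le:
  fixes \<delta> \<epsilon> t r :: real
  assumes "0 < \<delta>" "0 \<le> \<epsilon>" "0 < r"
  shows "(1 + \<delta>) * \<epsilon> + inverse r * (2/3 * (1 + \<delta>) * \<epsilon> + (1 + inverse \<delta>) / 4 * t\<^sup>2)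
    \<le> ((1 + \<delta>) + 2 * (1 + \<delta>) * (1 + inverse \<delta>) / (3 * r)) * \<epsilon>
      + (1 + inverse \<delta>) * (1 / 3 + ((1 + inverse \<delta>) / 4) powr (2 / 3)) * inverse r * t\<^sup>2"
proof -
  \<comment> \<open>The bound obtained is sharper than the target: the first term gains the factor
    \<open>1 + inverse \<delta>\<close>, and in the second 1/4 is at most 1/3 plus a nonnegative
    power.\<close>
  have "1 * (2 * (1 + \<delta>) / (3 * r) * \<epsilon>) \<le> (1 + inverse \<delta>) * (2 * (1 + \<delta>) / (3 * r) * \<epsilon>)"
    using assms by (intro mult_right_mono) auto
  moreover have "(1 + inverse \<delta>) * (1 / 4) * inverse r * t\<^sup>2
      \<le> (1 + inverse \<delta>) * (1 / 3 + ((1 + inverse \<delta>) / 4) powr (2 / 3)) * inverse r * t\<^sup>2"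
    using assms by (intro mult_right_mono mult_left_mono) (auto intro: add_increasing2)
  ultimately show ?thesis
    using assms by (simp add: field_simps)
qed

theorem theorem3:
  fixes M :: "'w measure"
    and X :: "'w \<Rightarrow> nat \<Rightarrow> real"
    and Y :: "'w \<Rightarrow> real"
    and Z :: "nat \<Rightarrow> 'w \<Rightarrow> real"
    and d k :: nat
    and \<delta> :: real
  assumes "prob_space M"
    and "d \<ge> 1"
    and "X \<in> measurable M (rspace d)"
    and "Y \<in> borel_measurable M"
    and "integrable M (\<lambda>\<omega>. (Y \<omega>)\<^sup>2)"
    and "marginally_atomless d M X"
    and "cyclic_minimax_process d M X Y Z"
    and "\<delta> > 0"
  shows "(\<integral>\<omega>. (Y \<omega> - Z k \<omega>)\<^sup>2 \<partial>M) \<le>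
    (INF g\<in>additive_class d.
       ((1 + \<delta>) + 2 * (1 + \<delta>) * (1 + inverse \<delta>) / (3 * 2 powr (2 * real (k div d) / 3)))
         * (\<integral>\<omega>. (Y \<omega> - g (X \<omega>))\<^sup>2 \<partial>M)
       + (1 + inverse \<delta>) * (1 / 3 + ((1 + inverse \<delta>) / 4) powr (2 / 3))
         * 2 powr (- 2 * real (k div d) / 3) * (tv_norm d g)\<^sup>2)"
proof (rule cINF_greatest)
  \<comment> \<open>The zero function shows that the infimum is over a nonempty set.\<close>
  have "additive_rep d (\<lambda>_. 0) (\<lambda>_ _. 0)"
    by (auto simp: additive_rep_def bounded_variation_def variation_sums_def intro!: bdd_aboveI[of _ 0])
  then show "additive_class d \<noteq> {}"
    unfolding additive_class_def by blast
next
  fix g assume g: "g \<in> additive_class d"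
  obtain \<pi> where \<pi>: "cyclic_minimax_partitions d M X Y \<pi>" and Z: "associated_process M X Y \<pi> Z"
    using assms(7) unfolding cyclic_minimax_process_def by blast
  interpret cyclic_minimax M d X Y \<pi>
    by (rule cyclic_minimax.intro[OF assms(1) cyclic_minimax_axioms.intro[OF assms(2-6) \<pi>]])
  let ?r = "2 powr (2 * real (k div d) / 3) :: real"
  let ?\<epsilon> = "\<integral>\<omega>. (Y \<omega> - g (X \<omega>))\<^sup>2 \<partial>M"
  let ?bound = "\<lambda>t. ((1 + \<delta>) + 2 * (1 + \<delta>) * (1 + inverse \<delta>) / (3 * ?r)) * ?\<epsilon>
    + (1 + inverse \<delta>) * (1 / 3 + ((1 + inverse \<delta>) / 4) powr (2 / 3)) * 2 powr (- 2 * real (k div d) / 3) * t\<^sup>2"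
  let ?S = "{(\<Sum>i\<in>{1..d}. total_variation (h i)) | h. additive_rep d g h}"
  have S: "?S \<noteq> {}" using g unfolding additive_class_def by blast
  have "0 \<le> v" if "v \<in> ?S" for v
  proof -
    from that obtain h where h: "v = (\<Sum>i\<in>{1..d}. total_variation (h i))" "additive_rep d g h" by blast
    have "0 \<le> total_variation (h i)" if "i \<in> {1..d}" for i
    proof -
      have "bounded_variation (h i)" using h(2) that by (simp add: additive_rep_def)
      then obtain F :: "real \<Rightarrow> real" where F: "\<forall>x y. F y - F x \<le> total_variation (h i)"
        using variation_function by blast
      from F[rule_format, of 0 0] show ?thesis by simp
    qed
    then show ?thesis unfolding h(1) by (rule sum_nonneg)
  qed
  then have tv0: "0 \<le> tv_norm d g"
    unfolding tv_norm_def using S by (intro cInf_greatest)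
  \<comment> \<open>The infimum defining \<open>tv_norm\<close> need not be attained, so the bound
    is first shown for every larger \<open>t\<close>; such a \<open>t\<close> is positive and
    exceeds the sum of variations of some representation.\<close>
  have "(\<integral>\<omega>. (Y \<omega> - Z k \<omega>)\<^sup>2 \<partial>M) \<le> ?bound t" if t: "tv_norm d g < t" for t
  proof -
    obtain v where v: "v \<in> ?S" "v < t"
      using cInf_lessD[OF S] t unfolding tv_norm_def by blast
    then obtain h where h: "additive_rep d g h" "(\<Sum>i\<in>{1..d}. total_variation (h i)) \<le> t"
      by auto
    have "(\<integral>\<omega>. (Y \<omega> - Z k \<omega>)\<^sup>2 \<partial>M) \<le> (1 + \<delta>) * ?\<epsilon>
        + inverse ?r * (2/3 * (1 + \<delta>) * ?\<epsilon> + (1 + inverse \<delta>) / 4 * t\<^sup>2)"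
      using sum_wvar_partition_le[OF h(1) assms(8) _ h(2), of k] tv0 t
      by (simp add: mean_square_error[OF Z] powr_minus[symmetric])
    also have "\<dots> \<le> ?bound t"
      using rate_constants_le[OF assms(8), of ?\<epsilon> ?r t] by (simp add: powr_minus[symmetric])
    finally show ?thesis .
  qed
  \<comment> \<open>Letting \<open>t\<close> decrease to \<open>tv_norm d g\<close> preserves the
    inequality, as the bound is continuous in \<open>t\<close>.\<close>
  then have "eventually (\<lambda>t. (\<integral>\<omega>. (Y \<omega> - Z k \<omega>)\<^sup>2 \<partial>M) \<le> ?bound t) (at_right (tv_norm d g))"
    by (simp add: eventually_at_right_less eventually_mono[OF eventually_at_right_less])
  moreover have "(?bound \<longlongrightarrow> ?bound (tv_norm d g)) (at_right (tv_norm d g))"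
    by (intro tendsto_intros)
  ultimately show "(\<integral>\<omega>. (Y \<omega> - Z k \<omega>)\<^sup>2 \<partial>M) \<le> ?bound (tv_norm d g)"
    by (intro tendsto_lowerbound) auto
qed

end
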